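(* Let $k \geq 2$ be an integer and let $G$ be a $k$-connected graph with $n \geq 3$ vertices and $e$ edges, minimum degree $\delta$ and maximum degree $\Delta$. If $$M_1(G) \geq (n - k - 1)\Delta^2 + \frac{\bigl(e (\delta + n - k - 1)\bigr)^2}{4 \delta (n - k - 1)(k + 1)},$$ then $G$ is Hamiltonian or $G$ is the complete bipartite graph $K_{k,\, k+1}$.
   Context: All graphs are finite, undirected, without loops or multiple edges. For a graph $G$, $d_G(u)$ denotes the degree of a vertex $u$, $\delta$ and $\Delta$ denote the minimum and maximum degree of $G$, and the first Zagreb index is $M_1(G) = \sum_{u \in V(G)} d_G^2(u)$. A graph is Hamiltonian if it has a cycle containing all its vertices. $K_{a,b}$ denotes the complete bipartite graph with parts of sizes $a$ and $b$. *)

theory Defs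
  imports Complex_Main "Graph_Theory.Graph_Theory"
begin

text \<open>
  A finite simple undirected graph is a \<^locale>\<open>graph\<close>: a finite loop-free symmetric digraph without
  parallel arcs. An undirected edge \<open>uv\<close> is represented by the two arcs \<open>(u, v)\<close> and \<open>(v, u)\<close>, so the
  degree of \<open>u\<close> is \<^term>\<open>out_degree G u\<close>, and edges have to be counted as unordered pairs.
\<close>

definition edges :: "('a, 'b) pre_digraph \<Rightarrow> 'a set set" where
  "edges G = {{u, v} | u v. u \<rightarrow>\<^bsub>G\<^esub> v}"

definition min_degree :: "('a, 'b) pre_digraph \<Rightarrow> nat" where
  "min_degree G = Min (out_degree G ` verts G)"

definition max_degree :: "('a, 'b) pre_digraph \<Rightarrow> nat" where
  "max_degree G = Max (out_degree G ` verts G)"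

definition first_zagreb :: "('a, 'b) pre_digraph \<Rightarrow> nat" where
  "first_zagreb G = (\<Sum>u\<in>verts G. (out_degree G u)\<^sup>2)"

text \<open>
  The usual convention: more than \<open>k\<close> vertices, and deleting fewer than \<open>k\<close> of them never
  disconnects the graph. In particular the complete graph on \<open>k + 1\<close> vertices is \<open>k\<close>-connected.
\<close>

definition k_connected :: "nat \<Rightarrow> ('a, 'b) pre_digraph \<Rightarrow> bool" where
  "k_connected k G \<longleftrightarrow> k < card (verts G) \<and>
     (\<forall>S. S \<subseteq> verts G \<and> card S < k \<longrightarrow> Digraph_Component.connected (G \<restriction> (verts G - S)))"

text \<open>
  In a symmetric digraph \<^const>\<open>pre_digraph.cycle\<close> also accepts the walk \<open>u, v, u\<close>, which is not a cycle
  of the undirected graph; the bound on the length excludes it. The vertices of a cycle are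
  the tails of its arcs.
\<close>

definition hamiltonian :: "('a, 'b) pre_digraph \<Rightarrow> bool" where
  "hamiltonian G \<longleftrightarrow>
     (\<exists>p. pre_digraph.cycle G p \<and> 3 \<le> length p \<and> tail G ` set p = verts G)"

end

theory Submission
  imports Defs
begin

text \<open>
  If \<open>G\<close> is not Hamiltonian, the Chvatal--Erdos theorem yields an independent set \<open>I\<close> of size
  \<open>k + 1\<close>. Its degrees lie between \<open>\<delta>\<close> and \<open>n - k - 1\<close> and add up to at most \<open>e\<close>, so the
  Diaz--Metcalf inequality bounds its part of the Zagreb index by the second summand of the
  hypothesis; the other vertices contribute at most the first summand. Equality must then hold
  everywhere, which makes \<open>G\<close> a complete bipartite graph with parts of sizes \<open>k + 1\<close> and
  \<open>n - k - 1 \<in> {k, k + 1}\<close>, and \<open>K\<^bsub>k+1,k+1\<^esub>\<close> is Hamiltonian.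

  The Chvatal--Erdos theorem does not need Menger's theorem: let \<open>C\<close> be a longest cycle, \<open>D\<close> a
  component of \<open>G - C\<close> and \<open>A\<close> the set of vertices of \<open>C\<close> with a neighbour in \<open>D\<close>. Since \<open>C\<close> cannot
  be rerouted through \<open>D\<close>, the successors of \<open>A\<close> on \<open>C\<close> together with a vertex of \<open>D\<close> are
  independent and \<open>A \<noteq> C\<close>, so \<open>A\<close> separates \<open>D\<close> from \<open>C - A\<close> and has at least \<open>k\<close> elements.
\<close>

section \<open>Lists\<close>

text \<open>When a step reaches a vertex already on the path, the path is cut at that occurrence.
  The last clause keeps the path within the part reachable from \<open>x\<close>, so that it later
  stays inside one component.\<close>

lemma rtranclp_distinct_path:
  assumes "R\<^sup>*\<^sup>* x y"
  obtains zs where "zs \<noteq> []" "hd zs = x" "last zs = y" "distinct zs" "successively R zs"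
    "set zs \<subseteq> {z. R\<^sup>*\<^sup>* x z}"
proof -
  from assms have "\<exists>zs. zs \<noteq> [] \<and> hd zs = x \<and> last zs = y \<and> distinct zs \<and> successively R zs
    \<and> set zs \<subseteq> {z. R\<^sup>*\<^sup>* x z}"
  proof induction
    case base
    show ?case by (rule exI[of _ "[x]"]) auto
  next
    case (step y z)
    then obtain zs where zs: "zs \<noteq> []" "hd zs = x" "last zs = y" "distinct zs" "successively R zs"
      "set zs \<subseteq> {z. R\<^sup>*\<^sup>* x z}"
      by blast
    show ?case
    proof (cases "z \<in> set zs")
      case True
      then obtain us vs where "zs = us @ z # vs"
        by (meson split_list)
      with zs show ?thesis
        by (intro exI[of _ "us @ [z]"]) (auto simp: successively_append_iff hd_append)
    next
      case False
      with zs step.hyps show ?thesis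
        by (intro exI[of _ "zs @ [z]"])
          (auto simp: successively_append_iff intro: rtranclp.rtrancl_into_rtrancl)
    qed
  qed
  then show ?thesis using that by blast
qed

text \<open>Here and below, \<open>rotate1 xs ! i\<close> serves as the cyclic successor of
  \<open>xs ! i\<close>, with the wrap-around at the last index built in.\<close>

lemma hd_rotate_Suc:
  assumes "i < length xs"
  shows "hd (rotate (Suc i) xs) = rotate1 xs ! i"
proof -
  have "hd (rotate (Suc i) xs) = rotate (Suc i) xs ! 0"
    using assms by (subst hd_conv_nth) auto
  also have "\<dots> = xs ! (Suc i mod length xs)"
    using assms by (subst nth_rotate) auto
  finally show ?thesis using assms by (simp add: nth_rotate1)
qed

lemma last_rotate_Suc:
  assumes "i < length xs"
  shows "last (rotate (Suc i) xs) = xs ! i"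
proof -
  have "last (rotate (Suc i) xs) = rotate (Suc i) xs ! (length xs - 1)"
    using assms by (subst last_conv_nth) auto
  also have "\<dots> = xs ! ((Suc i + (length xs - 1)) mod length xs)"
    using assms by (subst nth_rotate) auto
  also have "Suc i + (length xs - 1) = i + length xs"
    using assms by auto
  finally show ?thesis using assms by simp
qed

text \<open>Cutting a cycle right behind positions \<open>i\<close> and \<open>j\<close> leaves two
  segments: \<open>ps\<close> from the successor of \<open>xs ! i\<close> to \<open>xs ! j\<close>,
  and \<open>qs\<close> from the successor of \<open>xs ! j\<close> round to \<open>xs ! i\<close>.
  Reversing \<open>ps\<close> will later reroute the cycle along a chord.\<close>

lemma rotate_Suc_split:
  assumes "i < j" "j < length xs"
  obtains ps qs where "rotate (Suc i) xs = ps @ qs" "ps \<noteq> []" "qs \<noteq> []"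
    "hd ps = rotate1 xs ! i" "last ps = xs ! j" "hd qs = rotate1 xs ! j" "last qs = xs ! i"
proof -
  define r where "r = rotate (Suc i) xs"
  have len: "length r = length xs" by (simp add: r_def)
  have nth: "r ! m = xs ! ((Suc i + m) mod length xs)" if "m < length xs" for m
    unfolding r_def using that by (rule nth_rotate)
  let ?ps = "take (j - i) r" and ?qs = "drop (j - i) r"
  have ne: "?ps \<noteq> []" "?qs \<noteq> []" using assms len by auto
  have "hd ?ps = rotate1 xs ! i"
    using assms ne hd_rotate_Suc[of i xs] by (simp add: r_def)
  moreover have "last ?qs = xs ! i"
    using assms ne last_rotate_Suc[of i xs] by (simp add: r_def)
  moreover have "last ?ps = xs ! j"
  proof -
    have "last ?ps = r ! (j - i - 1)"
      using ne assms len by (subst last_conv_nth) (auto simp: min_def)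
    with assms show ?thesis by (simp add: nth)
  qed
  moreover have "hd ?qs = rotate1 xs ! j"
    using ne assms len by (simp add: hd_drop_conv_nth nth nth_rotate1)
  ultimately show ?thesis
    using that[of ?ps ?qs] ne unfolding r_def by simp
qed

section \<open>Cycles as vertex lists\<close>

text \<open>
  Since the graph is loop-free, a vertex cycle has at least two vertices; a single edge counts as
  one, which makes the choice of a longest vertex cycle possible in any graph with an edge.
\<close>

definition (in pre_digraph) vertex_cycle :: "'a list \<Rightarrow> bool" where
  "vertex_cycle xs \<longleftrightarrow> xs \<noteq> [] \<and> distinct xs \<and> set xs \<subseteq> verts G
     \<and> successively (dominates G) xs \<and> last xs \<rightarrow> hd xs"

context pre_digraph
begin

lemma vertex_cycle_rotate1:
  assumes "vertex_cycle xs"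
  shows "vertex_cycle (rotate1 xs)"
  using assms
  by (cases xs) (auto simp: vertex_cycle_def successively_append_iff successively_Cons hd_append)

lemma vertex_cycle_rotate: "vertex_cycle xs \<Longrightarrow> vertex_cycle (rotate m xs)"
  by (induction m) (auto intro: vertex_cycle_rotate1)

text \<open>The end vertex \<open>v\<close> is kept apart because the tails of the arcs omit it;
  \<open>v = hd xs\<close> gives the closed walk of a cycle.\<close>

lemma ex_cas_if_successively:
  assumes "successively (dominates G) (xs @ [v])" "xs \<noteq> []"
  shows "\<exists>p. cas (hd xs) p v \<and> set p \<subseteq> arcs G \<and> map (tail G) p = xs"
  using assms
proof (induction xs)
  case (Cons x xs)
  have "x \<rightarrow> hd (xs @ [v])"
    using Cons.prems by (cases xs) auto
  then obtain a where a: "a \<in> arcs G" "tail G a = x" "head G a = hd (xs @ [v])"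
    by auto
  show ?case
  proof (cases "xs = []")
    case True
    with a show ?thesis by (intro exI[of _ "[a]"]) auto
  next
    case False
    with Cons obtain p where "cas (hd xs) p v" "set p \<subseteq> arcs G" "map (tail G) p = xs"
      by (auto simp: successively_Cons)
    with a False show ?thesis by (intro exI[of _ "a # p"]) auto
  qed
qed simp

lemma hamiltonian_if_vertex_cycle:
  assumes "vertex_cycle xs" "set xs = verts G" "3 \<le> card (verts G)"
  shows "hamiltonian G"
proof -
  from assms(1) have xs: "xs \<noteq> []" "distinct xs" "successively (dominates G) (xs @ [hd xs])"
    by (auto simp: vertex_cycle_def successively_append_iff)
  from ex_cas_if_successively[OF xs(3,1)] obtain p
    where p: "cas (hd xs) p (hd xs)" "set p \<subseteq> arcs G" "map (tail G) p = xs"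
    by blast
  then have "p \<noteq> []" using xs by auto
  have "awalk_verts (hd xs) p = hd xs # map (head G) p"
    using awalk_verts_conv'[OF p(1)] \<open>p \<noteq> []\<close> p(3) by (auto simp: hd_map)
  \<comment> \<open>The last arc ends in \<open>hd xs\<close>, so dropping the first vertex of the
    walk leaves a rotation of \<open>xs\<close>; this is the distinctness that \<open>cycle\<close>
    demands.\<close>
  moreover have "awalk_verts (hd xs) p = xs @ [head G (last p)]"
    using \<open>p \<noteq> []\<close> p(3) by (simp add: awalk_verts_conv)
  moreover have "head G (last p) = hd xs"
    using p(1) \<open>p \<noteq> []\<close> by (induction p arbitrary: xs rule: rev_induct) (auto simp: cas_append_iff)
  ultimately have "tl (awalk_verts (hd xs) p) = tl xs @ [hd xs]"
    using xs(1) by (cases xs) auto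
  with xs have "distinct (tl (awalk_verts (hd xs) p))"
    by (cases xs) auto
  moreover have "awalk (hd xs) p (hd xs)"
    using p xs assms(2) hd_in_set[of xs] by (auto simp: awalk_def)
  ultimately have "cycle p"
    using \<open>p \<noteq> []\<close> by (auto simp: cycle_def)
  moreover have "tail G ` set p = verts G"
    using p(3) assms(2) by (metis set_map)
  moreover have "length p = card (verts G)"
    using p(3) assms(2) xs(2) by (metis distinct_card length_map)
  ultimately show ?thesis using assms(3) by (auto simp: hamiltonian_def)
qed

end

section \<open>The Chvatal--Erdos theorem\<close>

text \<open>Deleting \<open>S\<close> leaves a connected graph, and a nonempty set closed under
  adjacency absorbs every vertex along a path. Both arc directions occur in \<open>closed\<close>
  because connectedness is defined via the symmetric closure.\<close>

lemma (in wf_digraph) k_connected_closed_eq: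
  assumes "k_connected k G" "S \<subseteq> verts G" "card S < k" "T \<subseteq> verts G - S" "T \<noteq> {}"
    and closed: "\<And>x y. \<lbrakk>x \<in> T; x \<rightarrow> y \<or> y \<rightarrow> x; y \<in> verts G - S\<rbrakk> \<Longrightarrow> y \<in> T"
  shows "T = verts G - S"
proof (intro equalityI subsetI)
  fix w assume w: "w \<in> verts G - S"
  let ?H = "G \<restriction> (verts G - S)"
  obtain v where v: "v \<in> T" using assms by blast
  have "Digraph_Component.connected ?H"
    using assms by (auto simp: k_connected_def)
  then have reach: "v \<rightarrow>\<^sup>*\<^bsub>with_proj (mk_symmetric ?H)\<^esub> w"
    using v w assms by (auto simp: Digraph_Component.connected_def strongly_connected_def)
  interpret H: wf_digraph "?H" by auto
  interpret M: pair_wf_digraph "mk_symmetric ?H" by auto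
  have dominates_M: "x \<in> verts G - S \<and> y \<in> verts G - S \<and> (x \<rightarrow> y \<or> y \<rightarrow> x)"
    if "x \<rightarrow>\<^bsub>with_proj (mk_symmetric ?H)\<^esub> y" for x y
    using that by (auto simp: mk_symmetric_def arcs_ends_conv)
  from reach show "w \<in> T"
  proof (induction rule: M.reachable_induct)
    case (step x y)
    then have "x \<rightarrow>\<^bsub>with_proj (mk_symmetric ?H)\<^esub> y" by simp
    from \<open>x \<in> T\<close> dominates_M[OF this] show ?case using closed by blast
  qed (use v in simp)
qed (use assms in blast)

context graph
begin

lemma dominates_sym: "u \<rightarrow> v \<Longrightarrow> v \<rightarrow> u"
  using sym_arcs by (rule arcs_ends_symmetric)

lemma out_degree_eq_card_dominates: "out_degree G u = card {v. u \<rightarrow> v}"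
proof -
  have "inj_on (head G) (out_arcs G u)"
    by (rule inj_onI) (auto intro!: no_multi_arcs simp: arc_to_ends_def)
  moreover have "head G ` out_arcs G u = {v. u \<rightarrow> v}"
    by (auto simp: arcs_ends_conv)
  ultimately show ?thesis by (metis out_degree_def card_image)
qed

lemma finite_dominates: "finite {v. u \<rightarrow> v}"
  by (rule finite_subset[OF _ finite_verts]) (auto dest: adj_in_verts)

text \<open>The neighbourhood of \<open>u\<close> cuts \<open>u\<close> off from all other vertices.
  With fewer than \<open>k\<close> members it would leave only \<open>u\<close>, so \<open>G\<close>
  would have at most \<open>k\<close> vertices.\<close>

lemma k_connected_le_out_degree:
  assumes "k_connected k G" "u \<in> verts G"
  shows "k \<le> out_degree G u"
proof (rule ccontr)
  assume less: "\<not> k \<le> out_degree G u"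
  let ?S = "{v. u \<rightarrow> v}"
  have "{u} = verts G - ?S"
    using assms less
    by (intro k_connected_closed_eq[where k = k])
      (auto simp: out_degree_eq_card_dominates dest: adj_in_verts adj_not_same dominates_sym)
  then have "verts G \<subseteq> insert u ?S" by blast
  then have "card (verts G) \<le> card (insert u ?S)"
    using finite_dominates by (intro card_mono) auto
  also have "\<dots> \<le> Suc (card ?S)"
    by (rule card_insert_le_m1) auto
  finally show False
    using less assms by (auto simp: k_connected_def out_degree_eq_card_dominates)
qed

theorem chvatal_erdos:
  assumes conn: "k_connected k G" and "2 \<le> k"
    and alpha: "\<And>I. \<lbrakk>I \<subseteq> verts G; card I = k + 1\<rbrakk> \<Longrightarrow> \<exists>u\<in>I. \<exists>v\<in>I. u \<rightarrow> v"
  shows "\<exists>xs. vertex_cycle xs \<and> set xs = verts G"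
proof -
  have "verts G \<noteq> {}" using conn by (auto simp: k_connected_def)
  then obtain u where u: "u \<in> verts G" by blast
  then have "card {v. u \<rightarrow> v} \<noteq> 0"
    using k_connected_le_out_degree[OF conn u] \<open>2 \<le> k\<close> by (simp add: out_degree_eq_card_dominates)
  then obtain w where "u \<rightarrow> w" by fastforce
  then have cyc0: "vertex_cycle [u, w]"
    using dominates_sym adj_not_same by (auto simp: vertex_cycle_def dest: adj_in_verts)
  have "length xs \<le> card (verts G)" if "vertex_cycle xs" for xs
    using that unfolding vertex_cycle_def by (metis card_mono distinct_card finite_verts)
  then obtain xs where cyc: "vertex_cycle xs"
    and longest: "\<And>ys. vertex_cycle ys \<Longrightarrow> length ys \<le> length xs"
    using ex_has_greatest_nat[of vertex_cycle, OF cyc0, of length "Suc (card (verts G))"]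
    by (metis less_Suc_eq_le)
  have xs: "xs \<noteq> []" "distinct xs" "set xs \<subseteq> verts G"
    using cyc by (auto simp: vertex_cycle_def)
  show ?thesis
  proof (rule ccontr)
    assume "\<not> ?thesis"
    then obtain v where v: "v \<in> verts G" "v \<notin> set xs" using cyc xs by blast
    \<comment> \<open>\<open>R\<close> is adjacency off the cycle. Taking \<open>D\<close> as the
      set of vertices \<open>R\<close>-reachable from \<open>v\<close> makes paths inside
      \<open>D\<close> available through reachability.\<close>
    define R where "R x y \<longleftrightarrow> x \<rightarrow> y \<and> x \<notin> set xs \<and> y \<notin> set xs" for x y
    define D where "D = {x. R\<^sup>*\<^sup>* v x}"
    define A where "A = {a \<in> set xs. \<exists>x\<in>D. a \<rightarrow> x}"
    have D_notin: "x \<notin> set xs \<and> x \<in> verts G" if "x \<in> D" for x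
    proof -
      from that have "R\<^sup>*\<^sup>* v x" by (simp add: D_def)
      then show ?thesis
        by induction (use v in \<open>auto simp: R_def dest: adj_in_verts\<close>)
    qed
    have D_conn: "R\<^sup>*\<^sup>* x y" if "x \<in> D" "y \<in> D" for x y
    proof -
      have "symp R" by (auto intro!: sympI simp: R_def intro: dominates_sym)
      then have "R\<^sup>*\<^sup>* x v"
        using that(1) by (simp add: D_def) (metis sympD symp_rtranclp)
      then show ?thesis using that(2) by (simp add: D_def)
    qed
    have detour: "\<exists>zs. zs \<noteq> [] \<and> distinct zs \<and> set zs \<subseteq> D \<and> successively (dominates G) zs
        \<and> a \<rightarrow> hd zs \<and> last zs \<rightarrow> b" if "a \<in> A" "b \<in> A" for a b
    proof -
      from that obtain x y where xy: "x \<in> D" "y \<in> D" "a \<rightarrow> x" "b \<rightarrow> y"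
        by (auto simp: A_def)
      obtain zs where zs: "zs \<noteq> []" "hd zs = x" "last zs = y" "distinct zs" "successively R zs"
        "set zs \<subseteq> {z. R\<^sup>*\<^sup>* x z}"
        using rtranclp_distinct_path[OF D_conn[OF xy(1,2)]] by blast
      have "successively (dominates G) zs"
        using zs(5) by (rule successively_mono) (auto simp: R_def)
      moreover have "set zs \<subseteq> D"
        using zs(6) xy(1) by (auto simp: D_def)
      ultimately show ?thesis using zs xy dominates_sym by auto
    qed
    define J where "J = {i. i < length xs \<and> xs ! i \<in> A}"
    define P where "P = (\<lambda>i. rotate1 xs ! i) ` J"
    have P_subset: "P \<subseteq> set xs"
      by (auto simp: P_def J_def) (metis length_rotate1 nth_mem set_rotate1)
    \<comment> \<open>Otherwise a detour through \<open>D\<close> fits between \<open>xs ! i\<close>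
      and its successor and lengthens the cycle.\<close>
    have not_A: "rotate1 xs ! i \<notin> A" if "i \<in> J" for i
    proof
      assume *: "rotate1 xs ! i \<in> A"
      let ?ys = "rotate (Suc i) xs"
      have i: "i < length xs" "xs ! i \<in> A" using that by (auto simp: J_def)
      obtain zs where zs: "zs \<noteq> []" "distinct zs" "set zs \<subseteq> D" "successively (dominates G) zs"
        "xs ! i \<rightarrow> hd zs" "last zs \<rightarrow> rotate1 xs ! i"
        using detour[OF i(2) *] by blast
      have "vertex_cycle ?ys" using cyc by (rule vertex_cycle_rotate)
      then have "vertex_cycle (?ys @ zs)"
        using zs D_notin hd_rotate_Suc[OF i(1)] last_rotate_Suc[OF i(1)]
        by (auto simp: vertex_cycle_def successively_append_iff simp del: rotate_Suc)
      then show False using longest zs(1) by fastforce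
    qed
    \<comment> \<open>A chord between two successors yields a longer cycle: from
      \<open>xs ! j\<close> backwards along \<open>ps\<close>, over the chord, forwards along
      \<open>qs\<close> to \<open>xs ! i\<close>, and back to \<open>xs ! j\<close> through
      \<open>D\<close>.\<close>
    have P_indep: "\<not> rotate1 xs ! i \<rightarrow> rotate1 xs ! j" if "i \<in> J" "j \<in> J" "i < j" for i j
    proof
      assume *: "rotate1 xs ! i \<rightarrow> rotate1 xs ! j"
      have ij: "j < length xs" "xs ! i \<in> A" "xs ! j \<in> A" using that by (auto simp: J_def)
      obtain ps qs where split: "rotate (Suc i) xs = ps @ qs" "ps \<noteq> []" "qs \<noteq> []"
        "hd ps = rotate1 xs ! i" "last ps = xs ! j" "hd qs = rotate1 xs ! j" "last qs = xs ! i"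
        using rotate_Suc_split[OF \<open>i < j\<close> ij(1)] by blast
      obtain zs where zs: "zs \<noteq> []" "distinct zs" "set zs \<subseteq> D" "successively (dominates G) zs"
        "xs ! i \<rightarrow> hd zs" "last zs \<rightarrow> xs ! j"
        using detour[OF ij(2,3)] by blast
      have sets: "set ps \<union> set qs = set xs"
        using arg_cong[OF split(1), of set] by simp
      have "vertex_cycle (ps @ qs)"
        using vertex_cycle_rotate[OF cyc] split(1) by metis
      moreover have "successively (dominates G) (rev ps)"
        if "successively (dominates G) ps"
        using that dominates_sym by (auto simp: successively_rev elim: successively_mono)
      ultimately have "vertex_cycle (rev ps @ qs @ zs)"
        using zs D_notin sets split(2-) *
        by (auto simp: vertex_cycle_def successively_append_iff hd_rev last_rev hd_append)
      then have "length (rev ps @ qs @ zs) \<le> length xs" by (rule longest)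
      moreover have "length (ps @ qs) = length xs"
        by (simp flip: split(1))
      ultimately show False using zs(1) by (cases zs) auto
    qed
    \<comment> \<open>If all of the cycle were attached to \<open>D\<close>, the first vertex and
      its successor would be too, against \<open>not_A\<close>.\<close>
    have "set xs - A \<noteq> {}"
    proof
      assume "set xs - A = {}"
      then have "0 \<in> J" using xs(1) by (auto simp: J_def)
      then have "rotate1 xs ! 0 \<in> P" by (auto simp: P_def)
      then show False
        using P_subset \<open>set xs - A = {}\<close> not_A[OF \<open>0 \<in> J\<close>] by blast
    qed
    have "A \<subseteq> set xs" by (auto simp: A_def)
    \<comment> \<open>Adjacency leaves \<open>D\<close> only through \<open>A\<close>. If
      \<open>A\<close> were too small to separate, \<open>D\<close> would be all of
      \<open>G - A\<close>, with no room for the cycle vertices outside \<open>A\<close>.\<close>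
    have "k \<le> card A"
    proof (rule ccontr)
      assume "\<not> k \<le> card A"
      have "D = verts G - A"
      proof (rule k_connected_closed_eq[OF conn])
        show "D \<noteq> {}" by (auto simp: D_def)
        fix x y assume "x \<in> D" "x \<rightarrow> y \<or> y \<rightarrow> x" "y \<in> verts G - A"
        then have "R\<^sup>*\<^sup>* v x" "R x y"
          using D_notin dominates_sym by (auto simp: D_def A_def R_def)
        then show "y \<in> D" by (simp add: D_def)
      qed (use \<open>\<not> k \<le> card A\<close> \<open>A \<subseteq> set xs\<close> xs(3) D_notin in auto)
      with \<open>set xs - A \<noteq> {}\<close> xs(3) D_notin show False by blast
    qed
    also have "A = (\<lambda>i. xs ! i) ` J"
      by (auto simp: J_def A_def in_set_conv_nth)
    also have "card \<dots> \<le> card J"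
      by (rule card_image_le) (simp add: J_def)
    also have "card J = card P"
      unfolding P_def using xs(2)
      by (intro card_image[symmetric] inj_on_nth) (auto simp: J_def)
    finally have "k + 1 \<le> card (insert v P)"
      using P_subset v(2) finite_subset[OF P_subset] by (subst card_insert_disjoint) auto
    then obtain I where I: "I \<subseteq> insert v P" "card I = k + 1"
      using obtain_subset_with_card_n by metis
    then have "I \<subseteq> verts G" using P_subset v(1) xs(3) by auto
    then obtain x y where xy: "x \<in> insert v P" "y \<in> insert v P" "x \<rightarrow> y"
      using alpha[OF _ I(2)] I(1) by blast
    have "v \<in> D" by (simp add: D_def)
    then have "\<not> z \<rightarrow> v" if "z \<in> P" for z
      using that P_subset not_A by (auto simp: P_def A_def)
    moreover have "\<not> z \<rightarrow> z'" if zz: "z \<in> P" "z' \<in> P" for z z'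
    proof -
      obtain i j where "i \<in> J" "j \<in> J" "z = rotate1 xs ! i" "z' = rotate1 xs ! j"
        using zz by (auto simp: P_def)
      then show ?thesis
        using P_indep dominates_sym adj_not_same by (cases i j rule: linorder_cases) blast+
    qed
    ultimately show False
      using xy dominates_sym adj_not_same by blast
  qed
qed


section \<open>Degree sums over an independent set\<close>

lemma card_arcs_from:
  assumes "finite I"
  shows "card (Sigma I (\<lambda>u. {v. u \<rightarrow> v})) = (\<Sum>u\<in>I. out_degree G u)"
  using assms finite_dominates by (simp add: card_SigmaI out_degree_eq_card_dominates)

text \<open>An edge has at most one end in the independent set \<open>I\<close>, and this end
  determines its orientation.\<close>

lemma inj_on_edge_of_arc:
  assumes "\<And>u v. \<lbrakk>u \<in> I; v \<in> I\<rbrakk> \<Longrightarrow> \<not> u \<rightarrow> v"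
  shows "inj_on (\<lambda>(u, v). {u, v}) (Sigma I (\<lambda>u. {v. u \<rightarrow> v}))"
  using assms by (auto simp: inj_on_def doubleton_eq_iff)

lemma edge_of_arc_subset: "(\<lambda>(u, v). {u, v}) ` Sigma I (\<lambda>u. {v. u \<rightarrow> v}) \<subseteq> edges G"
  by (auto simp: edges_def)

lemma finite_edges: "finite (edges G)"
  by (rule finite_subset[of _ "Pow (verts G)"]) (auto simp: edges_def dest: adj_in_verts)

lemma sum_out_degree_le_edges:
  assumes "I \<subseteq> verts G" "\<And>u v. \<lbrakk>u \<in> I; v \<in> I\<rbrakk> \<Longrightarrow> \<not> u \<rightarrow> v"
  shows "(\<Sum>u\<in>I. out_degree G u) \<le> card (edges G)"
  using card_inj_on_le[OF inj_on_edge_of_arc edge_of_arc_subset finite_edges, of I] assms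
    card_arcs_from[of I] finite_subset[OF assms(1)]
  by simp

text \<open>In the case of equality the edges meeting \<open>I\<close> are as many as all edges, so
  no edge avoids \<open>I\<close>.\<close>

lemma sum_out_degree_eq_edgesD:
  assumes "I \<subseteq> verts G" "\<And>u v. \<lbrakk>u \<in> I; v \<in> I\<rbrakk> \<Longrightarrow> \<not> u \<rightarrow> v"
    and eq: "(\<Sum>u\<in>I. out_degree G u) = card (edges G)"
    and "x \<rightarrow> y"
  shows "x \<in> I \<or> y \<in> I"
proof -
  let ?f = "\<lambda>(u, v). {u, v}" and ?S = "Sigma I (\<lambda>u. {v. u \<rightarrow> v})"
  have "card (?f ` ?S) = card (edges G)"
    using card_image[OF inj_on_edge_of_arc[OF assms(2)]] card_arcs_from[of I] eq
      finite_subset[OF assms(1)]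
    by simp
  then have "?f ` ?S = edges G"
    using edge_of_arc_subset by (intro card_subset_eq finite_edges)
  moreover have "{x, y} \<in> edges G" using assms(4) by (auto simp: edges_def)
  ultimately have "{x, y} \<in> ?f ` ?S" by simp
  then obtain u v where "u \<in> I" "{x, y} = {u, v}" by auto
  then show ?thesis by (auto simp: doubleton_eq_iff)
qed

lemma min_degree_le: "u \<in> verts G \<Longrightarrow> min_degree G \<le> out_degree G u"
  by (simp add: min_degree_def)

lemma le_max_degree: "u \<in> verts G \<Longrightarrow> out_degree G u \<le> max_degree G"
  by (simp add: max_degree_def)

text \<open>Equal sizes allow the two parts to be listed alternately, and the list closes up from
  \<open>W\<close> back to \<open>U\<close>.\<close>

lemma vertex_cycle_complete_bipartite:
  assumes "finite U" "finite W" "card U = card W" "U \<noteq> {}" "U \<inter> W = {}"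
    and verts: "U \<union> W \<subseteq> verts G"
    and adj: "\<And>u w. \<lbrakk>u \<in> U; w \<in> W\<rbrakk> \<Longrightarrow> u \<rightarrow> w"
  shows "\<exists>xs. vertex_cycle xs \<and> set xs = U \<union> W"
proof -
  obtain us ws where us: "set us = U" "distinct us" and ws: "set ws = W" "distinct ws"
    using assms finite_distinct_list by metis
  have len: "length us = length ws"
    using us ws assms by (metis distinct_card)
  define f where "f us ws = concat (map2 (\<lambda>u w. [u, w]) us ws)" for us ws :: "'a list"
  have f_Cons: "f (u # us) (w # ws) = u # w # f us ws" for u w us ws
    by (simp add: f_def)
  have f_ends: "f us ws \<noteq> [] \<and> hd (f us ws) = hd us \<and> last (f us ws) = last ws
      \<and> set (f us ws) = set us \<union> set ws"
    if "length us = length ws" "us \<noteq> []" for us ws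
    using that
  proof (induction us ws rule: list_induct2)
    case (Cons u us w ws)
    then show ?case by (cases "us = []") (auto simp: f_Cons f_def)
  qed simp
  \<comment> \<open>Stated for lists inside \<open>U\<close> and \<open>W\<close>, since the tails
    met in the induction no longer exhaust the parts.\<close>
  have "successively (dominates G) (f us ws) \<and> distinct (f us ws)"
    if "length us = length ws" "set us \<subseteq> U" "set ws \<subseteq> W" "distinct us" "distinct ws" for us ws
    using that
  proof (induction us ws rule: list_induct2)
    case Nil
    then show ?case by (simp add: f_def)
  next
    case (Cons u us w ws)
    then have uw: "u \<in> U" "w \<in> W" by auto
    show ?case
    proof (cases "us = []")
      case True
      with Cons uw show ?thesis
        using adj[OF uw] assms(5) by (auto simp: f_def)
    next
      case False
      then have ends: "f us ws \<noteq> []" "hd (f us ws) = hd us" "set (f us ws) = set us \<union> set ws"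
        using f_ends[OF Cons.hyps] by auto
      have "hd us \<in> U" using False Cons.prems by (cases us) auto
      then have "w \<rightarrow> hd us" using adj uw(2) dominates_sym by blast
      then have "successively (dominates G) (f (u # us) (w # ws))"
        using Cons ends adj[OF uw] by (auto simp: f_Cons successively_Cons)
      moreover have "distinct (f (u # us) (w # ws))"
        using Cons uw ends(3) assms(5) by (auto simp: f_Cons)
      ultimately show ?thesis ..
    qed
  qed
  then have "successively (dominates G) (f us ws) \<and> distinct (f us ws)"
    using len us ws by blast
  moreover have ne: "us \<noteq> []" "ws \<noteq> []" using assms us len by auto
  then have "last ws \<rightarrow> hd us"
    using adj dominates_sym us ws by (metis hd_in_set last_in_set)
  ultimately have "vertex_cycle (f us ws)" "set (f us ws) = U \<union> W"
    using f_ends[OF len ne(1)] verts us ws by (auto simp: vertex_cycle_def)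
  then show ?thesis by blast
qed

end

section \<open>The equality case\<close>

text \<open>If all \<open>d u\<close> lie between \<open>a\<close> and \<open>b\<close>, the left
  side is nonnegative, which is the Diaz--Metcalf inequality. As an identity it also shows which
  \<open>d u\<close> give equality.\<close>

lemma diaz_metcalf_identity:
  fixes d :: "'a \<Rightarrow> real" and a b :: real
  shows "(\<Sum>u\<in>I. (d u - a) * (b - d u))
    = (a + b) * (\<Sum>u\<in>I. d u) - (\<Sum>u\<in>I. (d u)\<^sup>2) - real (card I) * (a * b)"
proof -
  have "(\<Sum>u\<in>I. (d u - a) * (b - d u)) = (\<Sum>u\<in>I. (a + b) * d u - (d u)\<^sup>2 - a * b)"
    by (rule sum.cong) (auto simp: power2_eq_square algebra_simps)
  then show ?thesis by (simp add: sum_subtractf sum_distrib_left)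
qed

theorem theorem1:
  fixes G :: "('a, 'b) pre_digraph" and k n e \<delta> \<Delta> :: nat
  assumes "graph G"
    and "k \<ge> 2"
    and "k_connected k G"
    and "n = card (verts G)" and "n \<ge> 3"
    and "e = card (edges G)"
    and "\<delta> = min_degree G"
    and "\<Delta> = max_degree G"
    and "real (first_zagreb G) \<ge>
      (real n - real k - 1) * (real \<Delta>)\<^sup>2
      + (real e * (real \<delta> + real n - real k - 1))\<^sup>2
        / (4 * real \<delta> * (real n - real k - 1) * (real k + 1))"
  shows "hamiltonian G \<or> complete_bipartite_digraph k (k + 1) G"
proof (rule disjCI)
  assume nonbip: "\<not> complete_bipartite_digraph k (k + 1) G"
  show "hamiltonian G"
  proof (rule ccontr)
    assume nonham: "\<not> hamiltonian G"
    interpret graph G by fact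
    let ?d = "out_degree G"
    have no_cycle: "\<not> (\<exists>xs. vertex_cycle xs \<and> set xs = verts G)"
      using hamiltonian_if_vertex_cycle nonham assms by blast
    then obtain I where I: "I \<subseteq> verts G" "card I = k + 1"
      and indep: "\<And>u v. \<lbrakk>u \<in> I; v \<in> I\<rbrakk> \<Longrightarrow> \<not> u \<rightarrow>\<^bsub>G\<^esub> v"
      using chvatal_erdos[OF assms(3,2)] by blast
    define W where "W = verts G - I"
    define m where "m = card W"
    have fin: "finite I" "finite W" using finite_subset[OF I(1)] by (auto simp: W_def)
    have verts: "verts G = I \<union> W" "I \<inter> W = {}" using I by (auto simp: W_def)
    have n: "n = k + 1 + m"
      using assms(4) verts fin I by (simp add: card_Un_disjoint m_def)
    have nbrs_I: "{v. u \<rightarrow>\<^bsub>G\<^esub> v} \<subseteq> W" if "u \<in> I" for u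
      using indep that by (auto simp: W_def dest: adj_in_verts)
    have d_le_m: "?d u \<le> m" if "u \<in> I" for u
      using card_mono[OF fin(2) nbrs_I[OF that]] by (simp add: out_degree_eq_card_dominates m_def)
    have "verts G \<noteq> {}" using assms by auto
    then have "\<delta> \<in> ?d ` verts G"
      by (auto simp: assms(7) min_degree_def intro!: Min_in)
    then have "k \<le> \<delta>"
      using k_connected_le_out_degree[OF assms(3)] by auto
    obtain u0 where "u0 \<in> I" using I by fastforce
    then have "\<delta> \<le> m"
      using d_le_m min_degree_le I assms(7) by (meson le_trans subsetD)
    have pos: "0 < \<delta>" "0 < m" using \<open>k \<le> \<delta>\<close> \<open>\<delta> \<le> m\<close> \<open>k \<ge> 2\<close> by auto
    \<comment> \<open>The constant \<open>c\<close> is the last term of the Diaz--Metcalf identity,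
      and \<open>4 * c\<close> is the denominator in the hypothesis.\<close>
    define S1 S2 T c where "S1 = (\<Sum>u\<in>I. real (?d u))" and "S2 = (\<Sum>u\<in>I. (real (?d u))\<^sup>2)"
      and "T = (\<Sum>u\<in>W. (real (?d u))\<^sup>2)" and "c = real (k + 1) * (real \<delta> * real m)"
    have c: "0 < c" using pos by (simp add: c_def)
    have S1: "S1 \<le> e"
      using sum_out_degree_le_edges[OF I(1) indep] assms(6)
      unfolding S1_def by (simp flip: of_nat_sum)
    have dm_nonneg: "0 \<le> (real (?d u) - \<delta>) * (m - real (?d u))" if "u \<in> I" for u
      using that d_le_m min_degree_le I assms(7) by (intro mult_nonneg_nonneg) auto
    have dm_eq: "(\<Sum>u\<in>I. (real (?d u) - \<delta>) * (m - real (?d u))) = (\<delta> + m) * S1 - S2 - c"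
      using diaz_metcalf_identity[of "\<lambda>u. real (?d u)" "real \<delta>" "real m" I] I(2)
      by (simp add: S1_def S2_def c_def)
    have dm: "S2 + c \<le> (\<delta> + m) * S1"
    proof -
      have "0 \<le> (\<Sum>u\<in>I. (real (?d u) - \<delta>) * (m - real (?d u)))"
        by (rule sum_nonneg) (rule dm_nonneg)
      then show ?thesis using dm_eq by simp
    qed
    have T: "T \<le> m * (real \<Delta>)\<^sup>2"
      unfolding T_def m_def using le_max_degree assms(8)
      by (intro sum_bounded_above power_mono) (auto simp: W_def)
    define E where "E = (real \<delta> + real m) * real e"
    have zagreb: "S2 + T \<ge> m * (real \<Delta>)\<^sup>2 + E\<^sup>2 / (4 * c)"
      using assms(9) verts fin n
      by (simp add: first_zagreb_def sum.union_disjoint S2_def T_def c_def E_def algebra_simps)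
    then have "E\<^sup>2 / (4 * c) \<le> S2" using T by simp
    then have ge: "E\<^sup>2 \<le> 4 * c * S2"
      using c by (simp add: field_simps)
    have "0 \<le> S2" by (simp add: S2_def sum_nonneg)
    have S1_E: "(real \<delta> + real m) * S1 \<le> E"
      using S1 by (simp add: E_def mult_left_mono)
    \<comment> \<open>AM-GM: \<open>4 c S2 \<le> (S2 + c)\<^sup>2\<close>, so all inequalities used so far are equalities.\<close>
    have "(S2 + c)\<^sup>2 \<le> E\<^sup>2"
      using dm S1_E \<open>0 \<le> S2\<close> c by (intro power_mono) auto
    then have "(S2 - c)\<^sup>2 \<le> 0"
      using ge by (simp add: power2_eq_square algebra_simps)
    then have S2: "S2 = c" by simp
    have "E\<^sup>2 \<le> (S2 + c)\<^sup>2"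
      using ge S2 by (simp add: power2_eq_square algebra_simps)
    then have "E \<le> S2 + c"
      by (rule power2_le_imp_le) (use c S2 in simp)
    then have E: "E = S2 + c" "(real \<delta> + real m) * S1 = E"
      using dm S1_E by auto
    then have "S1 = e" using pos mult_left_cancel[of "real \<delta> + real m" S1 e] by (simp add: E_def)
    \<comment> \<open>Now every edge has an end in \<open>I\<close>, so \<open>W\<close> is
      independent as well.\<close>
    then have "(\<Sum>u\<in>I. ?d u) = card (edges G)"
      using assms(6) unfolding S1_def by (simp flip: of_nat_sum)
    then have nbrs_W: "{v. w \<rightarrow>\<^bsub>G\<^esub> v} \<subseteq> I" if "w \<in> W" for w
      using sum_out_degree_eq_edgesD[OF I(1) indep] that by (auto simp: W_def)
    \<comment> \<open>As \<open>E = 2 * c\<close>, the second summand of the hypothesis is exactly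
      \<open>S2\<close>, so \<open>T\<close> must attain its upper bound and all of \<open>W\<close>
      has degree \<open>\<Delta>\<close>.\<close>
    have "E\<^sup>2 / (4 * c) = c"
      using E(1) S2 c by (simp add: field_simps power2_eq_square)
    then have T_eq: "T = m * (real \<Delta>)\<^sup>2" using zagreb T S2 by simp
    have dW: "?d w = \<Delta>" if "w \<in> W" for w
    proof -
      have "(\<Sum>w\<in>W. (real \<Delta>)\<^sup>2 - (real (?d w))\<^sup>2) = 0"
        using T_eq by (simp add: sum_subtractf T_def m_def)
      moreover have "0 \<le> (real \<Delta>)\<^sup>2 - (real (?d w))\<^sup>2" if "w \<in> W" for w
        using that le_max_degree assms(8) by (auto simp: W_def intro!: power_mono)
      ultimately have "(real \<Delta>)\<^sup>2 - (real (?d w))\<^sup>2 = 0"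
        using sum_nonneg_eq_0_iff[OF fin(2)] that by (metis (no_types, lifting))
      then show ?thesis by simp
    qed
    have dI: "?d u = \<delta> \<or> ?d u = m" if "u \<in> I" for u
    proof -
      have "(\<Sum>u\<in>I. (real (?d u) - \<delta>) * (m - real (?d u))) = 0"
        using dm_eq E by simp
      then have "(real (?d u) - \<delta>) * (m - real (?d u)) = 0"
        using sum_nonneg_eq_0_iff[OF fin(1), of "\<lambda>u. (real (?d u) - \<delta>) * (m - real (?d u))"]
          dm_nonneg that
        by blast
      then show ?thesis by auto
    qed
    \<comment> \<open>If all degrees in \<open>I\<close> were \<open>\<delta>\<close>, comparing
      \<open>S2\<close> with \<open>c\<close> would give \<open>\<delta> = m\<close> after all. A
      vertex of degree \<open>m\<close> yields \<open>m \<le> \<Delta>\<close>.\<close>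
    have "\<exists>u\<in>I. ?d u = m"
    proof (rule ccontr)
      assume *: "\<not> (\<exists>u\<in>I. ?d u = m)"
      then have "S2 = real (k + 1) * (real \<delta> * real \<delta>)"
        using dI I(2) by (simp add: S2_def power2_eq_square)
      then have "\<delta> = m" using S2 pos by (simp add: c_def)
      then show False using * dI \<open>u0 \<in> I\<close> by blast
    qed
    then have "m \<le> \<Delta>" using le_max_degree I(1) assms(8) by auto
    have "W \<noteq> {}" using pos(2) by (auto simp: m_def)
    then obtain w0 where "w0 \<in> W" by blast
    then have "\<Delta> \<le> k + 1"
      using card_mono[OF fin(1) nbrs_W] dW I(2) by (simp add: out_degree_eq_card_dominates)
    \<comment> \<open>Only \<open>m = k\<close> and \<open>m = k + 1\<close> remain. In the first
      case \<open>\<delta> = m\<close>, so each vertex of \<open>I\<close> sees all of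
      \<open>W\<close>; in the second \<open>\<Delta> = k + 1\<close>, so each vertex of
      \<open>W\<close> sees all of \<open>I\<close>.\<close>
    have adj: "u \<rightarrow>\<^bsub>G\<^esub> w" if "u \<in> I" "w \<in> W" for u w
    proof (cases "m \<le> k")
      case True
      then have "?d u = m" using dI[OF that(1)] \<open>k \<le> \<delta>\<close> \<open>\<delta> \<le> m\<close> by auto
      then have "{v. u \<rightarrow>\<^bsub>G\<^esub> v} = W"
        using nbrs_I[OF that(1)] fin(2)
        by (intro card_subset_eq) (auto simp: out_degree_eq_card_dominates m_def)
      then show ?thesis using that by blast
    next
      case False
      then have "?d w = k + 1" using dW[OF that(2)] \<open>m \<le> \<Delta>\<close> \<open>\<Delta> \<le> k + 1\<close> by simp
      then have "{v. w \<rightarrow>\<^bsub>G\<^esub> v} = I"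
        using nbrs_W[OF that(2)] fin(1) I(2)
        by (intro card_subset_eq) (auto simp: out_degree_eq_card_dominates)
      then show ?thesis using that dominates_sym by blast
    qed
    show False
    proof (cases "m \<le> k")
      case True
      have arcs: "arcs_ends G = W \<times> I \<union> I \<times> W"
      proof (intro equalityI subrelI)
        fix x y assume "x \<rightarrow>\<^bsub>G\<^esub> y"
        moreover have "x \<in> I \<union> W" using adj_in_verts(1)[OF \<open>x \<rightarrow>\<^bsub>G\<^esub> y\<close>] verts(1) by simp
        ultimately show "(x, y) \<in> W \<times> I \<union> I \<times> W"
          using nbrs_I[of x] nbrs_W[of x] by auto
      qed (auto intro: adj dominates_sym)
      have "complete_bipartite_digraph k (k + 1) G"
        unfolding complete_bipartite_digraph_def
      proof (intro conjI exI)
        show "graph G" by fact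
        show "verts G = W \<union> I" using verts(1) by (simp only: Un_commute)
        show "W \<inter> I = {}" using verts(2) by (simp only: Int_commute)
        show "card W = k" using True \<open>k \<le> \<delta>\<close> \<open>\<delta> \<le> m\<close> by (simp add: m_def)
      qed (use I(2) arcs in simp_all)
      with nonbip show False ..
    next
      case False
      then have "card I = card W"
        using I(2) \<open>m \<le> \<Delta>\<close> \<open>\<Delta> \<le> k + 1\<close> by (simp add: m_def)
      moreover have "I \<noteq> {}" using \<open>u0 \<in> I\<close> by blast
      ultimately have "\<exists>xs. vertex_cycle xs \<and> set xs = I \<union> W"
        using verts adj by (intro vertex_cycle_complete_bipartite fin) auto
      then show False using no_cycle verts(1) by simp
    qed
  qed
qed

end
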